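(* Let $q:\mathbb{R}\to\mathbb{C}$ be a potential in the Schwartz space, let $Q=\begin{pmatrix}0&q\\-\bar q&0\end{pmatrix}$ and $\sigma_3=\begin{pmatrix}1&0\\0&-1\end{pmatrix}$, and consider, for a spectral parameter $k\in\mathbb{C}$ and a vector function $\psi:\mathbb{R}\to\mathbb{C}^2$, the three quadratic eigenvalue problems (the DNLSE eigenvalue problems) $$\text{(I)}\quad \psi_x+ik^2\sigma_3\psi=kQ\psi,$$ $$\text{(II)}\quad \psi_x+ik^2\sigma_3\psi=kQ\psi+\tfrac{i}{4}Q^2\sigma_3\psi,$$ $$\text{(III)}\quad \psi_x+ik^2\sigma_3\psi=kQ\psi-\tfrac{i}{2}Q^2\sigma_3\psi.$$ Each of these problems can be written as a standard eigenvalue problem by introducing the transformation $\widehat\psi=k\psi$. That is, for each of (I), (II), (III) there is a $4\times4$ matrix linear differential operator $\mathcal{L}$ in $x$, depending on $q$ but not on $k$, such that for every $k\in\mathbb{C}$ and every differentiable $\psi:\mathbb{R}\to\mathbb{C}^2$, setting $\widehat\psi=k\psi$, the function $\psi$ satisfies the given problem with parameter $k$ if and only if $$\mathcal{L}\begin{pmatrix}\widehat\psi\\ \psi\end{pmatrix}=k\begin{pmatrix}\widehat\psi\\ \psi\end{pmatrix}.$$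
   Context: The problems (I), (II), (III) are the spatial parts of the Lax pairs of the Kaup-Newell equation (DNLSE I), the Chen-Lee-Liu equation (DNLSE II) and the Gerdzhikov-Ivanov equation (DNLSE III), respectively. A "standard eigenvalue problem" means one of the form $\mathcal{L}v=kv$ with $\mathcal{L}$ a linear operator independent of $k$, in contrast with a quadratic eigenvalue problem, in which $k^2$ appears. The subscript $x$ denotes the derivative with respect to $x$, and $\bar q$ is the complex conjugate of $q$. *)

theory Defs
  imports "HOL-Analysis.Analysis"
begin

definition ddx :: "(real \<Rightarrow> 'a::real_normed_vector) \<Rightarrow> real \<Rightarrow> 'a"
  where "ddx f = (\<lambda>x. vector_derivative f (at x))"

definition smooth :: "(real \<Rightarrow> 'a::real_normed_vector) \<Rightarrow> bool"
  where "smooth f \<longleftrightarrow> (\<forall>n x. (ddx ^^ n) f differentiable (at x))"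

definition schwartz :: "(real \<Rightarrow> complex) \<Rightarrow> bool"
  where "schwartz f \<longleftrightarrow>
    smooth f \<and> (\<forall>m n. bounded (range (\<lambda>x. x ^ m *\<^sub>R (ddx ^^ n) f x)))"

definition sigma3 :: "complex^2^2"
  where "sigma3 = vector [vector [1, 0], vector [0, - 1]]"

definition Qmat :: "(real \<Rightarrow> complex) \<Rightarrow> real \<Rightarrow> complex^2^2"
  where "Qmat q x = vector [vector [0, q x], vector [- cnj (q x), 0]]"

text \<open>
  The spatial Lax equations of the Kaup--Newell, Chen--Lee--Liu and Gerdzhikov--Ivanov
  equations. Since \<^const>\<open>vector_derivative\<close> is total, these predicates are only
  meaningful for differentiable \<open>\<psi>\<close>.
\<close>

definition DNLSE_I :: "(real \<Rightarrow> complex) \<Rightarrow> complex \<Rightarrow> (real \<Rightarrow> complex^2) \<Rightarrow> bool"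
  where "DNLSE_I q k \<psi> \<longleftrightarrow> (\<forall>x.
    ddx \<psi> x + (\<i> * k^2) *s (sigma3 *v \<psi> x) = k *s (Qmat q x *v \<psi> x))"

definition DNLSE_II :: "(real \<Rightarrow> complex) \<Rightarrow> complex \<Rightarrow> (real \<Rightarrow> complex^2) \<Rightarrow> bool"
  where "DNLSE_II q k \<psi> \<longleftrightarrow> (\<forall>x.
    ddx \<psi> x + (\<i> * k^2) *s (sigma3 *v \<psi> x) =
      k *s (Qmat q x *v \<psi> x) + (\<i> / 4) *s ((Qmat q x ** Qmat q x ** sigma3) *v \<psi> x))"

definition DNLSE_III :: "(real \<Rightarrow> complex) \<Rightarrow> complex \<Rightarrow> (real \<Rightarrow> complex^2) \<Rightarrow> bool"
  where "DNLSE_III q k \<psi> \<longleftrightarrow> (\<forall>x.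
    ddx \<psi> x + (\<i> * k^2) *s (sigma3 *v \<psi> x) =
      k *s (Qmat q x *v \<psi> x) - (\<i> / 2) *s ((Qmat q x ** Qmat q x ** sigma3) *v \<psi> x))"

text \<open>
  \<open>matrix_diff_op n L\<close>: \<open>L\<close> is a \<open>4 \<times> 4\<close> matrix linear differential operator of order at most
  \<open>n\<close> with smooth coefficients. Its action is the classical one only on \<open>n\<close> times
  differentiable functions.
\<close>

definition matrix_diff_op ::
    "nat \<Rightarrow> ((real \<Rightarrow> complex^4) \<Rightarrow> (real \<Rightarrow> complex^4)) \<Rightarrow> bool"
  where "matrix_diff_op n L \<longleftrightarrow>
    (\<exists>A :: nat \<Rightarrow> real \<Rightarrow> complex^4^4.
      (\<forall>j\<le>n. smooth (A j)) \<and> L = (\<lambda>v x. \<Sum>j\<le>n. A j x *v (ddx ^^ j) v x))"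

definition stack :: "complex^2 \<Rightarrow> complex^2 \<Rightarrow> complex^4"
  where "stack a b = vector [a $ 1, a $ 2, b $ 1, b $ 2]"

end

theory Submission
  imports Defs
begin

text \<open>
  Since \<open>\<sigma>\<^sub>3\<^sup>2 = 1\<close>, the equation \<open>\<psi>\<^sub>x + \<i>k\<^sup>2\<sigma>\<^sub>3\<psi> = kQ\<psi> + cQ\<^sup>2\<sigma>\<^sub>3\<psi>\<close> can be solved for
  \<open>k\<^sup>2\<psi> = k\<psi>h\<close>, where \<open>\<psi>h = k\<psi>\<close>:
  \<open>k\<psi>h = \<i>\<sigma>\<^sub>3\<psi>\<^sub>x - \<i>\<sigma>\<^sub>3Q\<psi>h - \<i>c\<sigma>\<^sub>3Q\<^sup>2\<sigma>\<^sub>3\<psi>\<close>. Together with \<open>k\<psi> = \<psi>h\<close> this is an eigenvalue problem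
  for \<open>(\<psi>h, \<psi>)\<close> whose coefficients do not involve \<open>k\<close>. As \<open>Q\<^sup>2 = -|q|\<^sup>2\<close>, the last term is
  \<open>\<i>c|q|\<^sup>2\<psi>\<close>. The three problems are the cases \<open>c = 0\<close>, \<open>\<i>/4\<close> and \<open>-\<i>/2\<close>.
\<close>

text \<open>A finite-order version of \<open>smooth\<close>, introduced so that closure properties
  can be proved by induction on \<open>n\<close> with the functions generalised. The index is
  shifted: \<open>smooth_upto n\<close> means differentiable \<open>n + 1\<close> times.\<close>

definition smooth_upto :: "nat \<Rightarrow> (real \<Rightarrow> 'a::real_normed_vector) \<Rightarrow> bool"
  where "smooth_upto n f \<longleftrightarrow> (\<forall>m\<le>n. \<forall>x. (ddx ^^ m) f differentiable (at x))"

lemma smooth_iff_smooth_upto: "smooth f \<longleftrightarrow> (\<forall>n. smooth_upto n f)"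
  unfolding smooth_def smooth_upto_def by auto

lemma smooth_upto_0: "smooth_upto 0 f \<longleftrightarrow> (\<forall>x. f differentiable (at x))"
  by (simp add: smooth_upto_def)

text \<open>Peels off the innermost derivative rather than the outermost, so an induction hypothesis
  can be applied to \<open>ddx f\<close>.\<close>

lemma smooth_upto_Suc:
  "smooth_upto (Suc n) f \<longleftrightarrow> (\<forall>x. f differentiable (at x)) \<and> smooth_upto n (ddx f)"
  by (auto simp: smooth_upto_def All_less_Suc2 funpow_swap1
      simp flip: less_Suc_eq_le)

lemma smooth_upto_imp_differentiable: "smooth_upto n f \<Longrightarrow> f differentiable (at x)"
  by (cases n) (auto simp: smooth_upto_0 smooth_upto_Suc)

lemma smooth_upto_SucD: "smooth_upto (Suc n) f \<Longrightarrow> smooth_upto n f"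
  by (simp add: smooth_upto_def)

lemma ddx_works:
  "f differentiable (at x) \<Longrightarrow> (f has_vector_derivative ddx f x) (at x)"
  by (simp add: ddx_def vector_derivative_works)

lemma ddx_eqI: "(\<And>x. (f has_vector_derivative f' x) (at x)) \<Longrightarrow> ddx f = f'"
  by (auto simp: ddx_def vector_derivative_at)

lemma smooth_upto_const: "smooth_upto n (\<lambda>x. c)"
proof (induction n arbitrary: c)
  case (Suc n)
  have "ddx (\<lambda>x. c) = (\<lambda>x. 0)"
    by (rule ddx_eqI) simp
  with Suc show ?case by (simp add: smooth_upto_Suc)
qed (simp add: smooth_upto_0)

lemma smooth_upto_add:
  "smooth_upto n f \<Longrightarrow> smooth_upto n g \<Longrightarrow> smooth_upto n (\<lambda>x. f x + g x)"
proof (induction n arbitrary: f g)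
  case (Suc n)
  have "ddx (\<lambda>x. f x + g x) = (\<lambda>x. ddx f x + ddx g x)"
    using Suc.prems
    by (intro ddx_eqI has_vector_derivative_add ddx_works)
      (auto simp: smooth_upto_Suc)
  with Suc show ?case by (simp add: smooth_upto_Suc)
qed (simp add: smooth_upto_0)

lemma (in bounded_linear) has_vector_derivative_ddx:
  assumes "g differentiable (at x)"
  shows "((\<lambda>x. f (g x)) has_vector_derivative f (ddx g x)) (at x)"
  by (rule has_vector_derivative[OF ddx_works[OF assms]])

lemma (in bounded_linear) smooth_upto: "smooth_upto n g \<Longrightarrow> smooth_upto n (\<lambda>x. f (g x))"
proof (induction n arbitrary: g)
  case 0
  then show ?case
    by (auto simp: smooth_upto_0 intro: differentiableI_vector[OF has_vector_derivative_ddx])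
next
  case (Suc n)
  have *: "((\<lambda>x. f (g x)) has_vector_derivative f (ddx g x)) (at x)" for x
    by (intro has_vector_derivative_ddx smooth_upto_imp_differentiable[OF Suc.prems])
  then have "ddx (\<lambda>x. f (g x)) = (\<lambda>x. f (ddx g x))"
    by (rule ddx_eqI)
  with Suc show ?case
    by (simp add: smooth_upto_Suc differentiableI_vector[OF *])
qed

lemma (in bounded_bilinear) has_vector_derivative_ddx:
  assumes "f differentiable (at x)" "g differentiable (at x)"
  shows "((\<lambda>x. prod (f x) (g x)) has_vector_derivative
    prod (f x) (ddx g x) + prod (ddx f x) (g x)) (at x)"
  by (rule has_vector_derivative[OF assms[THEN ddx_works]])

text \<open>By the Leibniz rule the derivative is a sum of two products, each pairing one
  undifferentiated factor with one derivative. All four functions are smooth up to \<open>n\<close>,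
  so the induction hypothesis covers both products.\<close>

lemma (in bounded_bilinear) smooth_upto:
  "smooth_upto n f \<Longrightarrow> smooth_upto n g \<Longrightarrow> smooth_upto n (\<lambda>x. prod (f x) (g x))"
proof (induction n arbitrary: f g)
  case 0
  then show ?case
    by (auto simp: smooth_upto_0 intro: differentiableI_vector[OF has_vector_derivative_ddx])
next
  case (Suc n)
  have *: "((\<lambda>x. prod (f x) (g x)) has_vector_derivative
      prod (f x) (ddx g x) + prod (ddx f x) (g x)) (at x)" for x
    by (intro has_vector_derivative_ddx Suc.prems[THEN smooth_upto_imp_differentiable])
  then have "ddx (\<lambda>x. prod (f x) (g x)) = (\<lambda>x. prod (f x) (ddx g x) + prod (ddx f x) (g x))"
    by (rule ddx_eqI)
  moreover have "smooth_upto n f" "smooth_upto n g" "smooth_upto n (ddx f)" "smooth_upto n (ddx g)"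
    using Suc.prems by (simp_all add: smooth_upto_Suc smooth_upto_SucD)
  ultimately show ?case
    by (simp add: smooth_upto_Suc differentiableI_vector[OF *] smooth_upto_add Suc.IH)
qed

lemma smooth_const: "smooth (\<lambda>x. c)"
  by (simp add: smooth_iff_smooth_upto smooth_upto_const)

lemma smooth_add: "smooth f \<Longrightarrow> smooth g \<Longrightarrow> smooth (\<lambda>x. f x + g x)"
  by (simp add: smooth_iff_smooth_upto smooth_upto_add)

lemma smooth_sum: "(\<And>i. i \<in> I \<Longrightarrow> smooth (f i)) \<Longrightarrow> smooth (\<lambda>x. \<Sum>i\<in>I. f i x)"
  by (induction I rule: infinite_finite_induct) (auto intro: smooth_const smooth_add)

lemma smooth_bounded_linear: "bounded_linear h \<Longrightarrow> smooth f \<Longrightarrow> smooth (\<lambda>x. h (f x))"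
  by (simp add: smooth_iff_smooth_upto bounded_linear.smooth_upto)

lemma smooth_mult:
  fixes f g :: "real \<Rightarrow> 'a::real_normed_algebra"
  shows "smooth f \<Longrightarrow> smooth g \<Longrightarrow> smooth (\<lambda>x. f x * g x)"
  by (simp add: smooth_iff_smooth_upto bounded_bilinear.smooth_upto[OF bounded_bilinear_mult])

lemma smooth_uminus: "smooth f \<Longrightarrow> smooth (\<lambda>x. - f x)"
  by (rule smooth_bounded_linear[OF bounded_linear_minus[OF bounded_linear_ident]])

lemma bounded_linear_axis: "bounded_linear (axis i :: 'a::real_normed_vector \<Rightarrow> 'a^'n::finite)"
proof (rule bounded_linear_intro[where K = 1])
  show "norm (axis i x :: 'a^'n) \<le> norm x * 1" for x :: 'a
    by (simp add: norm_vec_def L2_set_def axis_def if_distrib[of norm] if_distribR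
        if_distrib[of "\<lambda>x. x^2"] cong: if_cong)
qed (auto simp: vec_eq_iff axis_def)

text \<open>A vector function is the finite sum of its components embedded by the bounded linear
  maps \<open>axis i\<close>.\<close>

lemma smooth_vecI:
  fixes f :: "real \<Rightarrow> 'a::real_normed_vector^'n::finite"
  assumes "\<And>i. smooth (\<lambda>x. f x $ i)"
  shows "smooth f"
proof -
  have "f = (\<lambda>x. \<Sum>i\<in>UNIV. axis i (f x $ i))"
    by (auto simp: fun_eq_iff vec_eq_iff axis_def)
  then show ?thesis
    using smooth_sum[of UNIV "\<lambda>i x. axis i (f x $ i)"]
      smooth_bounded_linear[OF bounded_linear_axis assms] by metis
qed

lemma vector_4 [simp]:
  "(vector [w, x, y, z] :: 'a::zero^4) $ 1 = w"
  "(vector [w, x, y, z] :: 'a^4) $ 2 = x"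
  "(vector [w, x, y, z] :: 'a^4) $ 3 = y"
  "(vector [w, x, y, z] :: 'a^4) $ 4 = z"
  unfolding vector_def by simp_all

text \<open>For fixed \<open>k\<close> the stacked vector is a real-linear image of \<open>v\<close>
  in finite dimension, so stacking commutes with \<open>ddx\<close>.\<close>

lemma bounded_linear_stack: "bounded_linear (\<lambda>v. stack (k *s v) v)"
  unfolding linear_conv_bounded_linear[symmetric]
  by (rule linearI) (simp_all add: stack_def vec_eq_iff forall_4 distrib_left)

lemma ddx_stack:
  assumes "\<And>x. \<psi> differentiable (at x)"
  shows "ddx (\<lambda>x. stack (k *s \<psi> x) (\<psi> x)) = (\<lambda>x. stack (k *s ddx \<psi> x) (ddx \<psi> x))"
  by (rule ddx_eqI, rule bounded_linear.has_vector_derivative_ddx[OF bounded_linear_stack assms])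

text \<open>In 2 x 2 blocks, order 0 is \<open>-\<i>\<sigma>\<^sub>3Q\<close> and
  \<open>\<i>c|q|\<^sup>2\<close> above the identity and 0; order 1 has the single nonzero block
  \<open>\<i>\<sigma>\<^sub>3\<close> at the upper right.\<close>

definition lax_coeff :: "(real \<Rightarrow> complex) \<Rightarrow> complex \<Rightarrow> nat \<Rightarrow> real \<Rightarrow> complex^4^4"
  where "lax_coeff q c j x = (if j = 0
    then vector [vector [0, - \<i> * q x, \<i> * c * (q x * cnj (q x)), 0],
                 vector [- \<i> * cnj (q x), 0, 0, \<i> * c * (q x * cnj (q x))],
                 vector [1, 0, 0, 0],
                 vector [0, 1, 0, 0]]
    else vector [vector [0, 0, \<i>, 0], vector [0, 0, 0, - \<i>], 0, 0])"

definition lax_op :: "(real \<Rightarrow> complex) \<Rightarrow> complex \<Rightarrow> (real \<Rightarrow> complex^4) \<Rightarrow> real \<Rightarrow> complex^4"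
  where "lax_op q c = (\<lambda>v x. \<Sum>j\<le>1. lax_coeff q c j x *v (ddx ^^ j) v x)"

lemma smooth_lax_coeff:
  assumes "smooth q"
  shows "smooth (lax_coeff q c j)"
proof -
  have cnj: "smooth (\<lambda>x. cnj (q x))"
    by (rule smooth_bounded_linear[OF bounded_linear_cnj assms])
  have "\<forall>a b. smooth (\<lambda>x. lax_coeff q c j x $ a $ b)"
    unfolding lax_coeff_def
    by (cases "j = 0") (simp_all add: forall_4 smooth_const smooth_mult assms cnj smooth_uminus)
  then show ?thesis
    \<comment> \<open>A matrix is a vector of rows, so \<open>smooth_vecI\<close> applies twice,
      reducing to the entries.\<close>
    by (intro smooth_vecI) blast
qed

lemma matrix_diff_op_lax_op: "smooth q \<Longrightarrow> matrix_diff_op 1 (lax_op q c)"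
  unfolding matrix_diff_op_def lax_op_def by (blast intro: smooth_lax_coeff)

text \<open>Pointwise algebra, with \<open>p\<close> standing for the derivative. The upper two
  components are the Lax equation multiplied by the invertible matrix
  \<open>\<i>\<sigma>\<^sub>3\<close>; the lower two are identities. Nothing is divided by
  \<open>k\<close>, so \<open>k = 0\<close> is covered.\<close>

lemma lax_eq_iff:
  fixes v p :: "complex^2"
  shows "p + (\<i> * k^2) *s (sigma3 *v v) =
      k *s (Qmat q x *v v) + c *s ((Qmat q x ** Qmat q x ** sigma3) *v v) \<longleftrightarrow>
    lax_coeff q c 0 x *v stack (k *s v) v + lax_coeff q c 1 x *v stack (k *s p) p
      = k *s stack (k *s v) v"
proof -
  \<comment> \<open>The multipliers \<open>z\<close> used below, \<open>\<i>\<close> and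
    \<open>- \<i>\<close>, are the diagonal entries of \<open>\<i>\<sigma>\<^sub>3\<close>.\<close>
  have scaled: "a = b \<longleftrightarrow> c = d" if "z * (a - b) = c - d" "z \<noteq> 0" for a b c d z :: complex
    using that by auto
  have "p$1 + \<i> * k^2 * v$1 = k * (q x * v$2) - c * (q x * cnj (q x) * v$1) \<longleftrightarrow>
      \<i> * c * (q x * cnj (q x)) * v$1 - \<i> * q x * (k * v$2) + \<i> * p$1 = k * (k * v$1)"
    by (rule scaled[of \<i>]) (simp_all add: algebra_simps power2_eq_square)
  moreover have "p$2 - \<i> * k^2 * v$2 = c * (cnj (q x) * q x * v$2) - k * (cnj (q x) * v$1) \<longleftrightarrow>
      \<i> * c * (q x * cnj (q x)) * v$2 - \<i> * cnj (q x) * (k * v$1) - \<i> * p$2 = k * (k * v$2)"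
    by (rule scaled[of "- \<i>"]) (simp_all add: algebra_simps power2_eq_square)
  ultimately show ?thesis
    by (simp add: vec_eq_iff forall_2 forall_4 matrix_vector_mult_def matrix_matrix_mult_def
        sum_2 sum_4 stack_def lax_coeff_def sigma3_def Qmat_def)
qed

lemma lax_problem_iff:
  assumes "\<And>x. \<psi> differentiable (at x)"
  shows "(\<forall>x. ddx \<psi> x + (\<i> * k^2) *s (sigma3 *v \<psi> x) =
      k *s (Qmat q x *v \<psi> x) + c *s ((Qmat q x ** Qmat q x ** sigma3) *v \<psi> x)) \<longleftrightarrow>
    lax_op q c (\<lambda>x. stack (k *s \<psi> x) (\<psi> x)) = (\<lambda>x. k *s stack (k *s \<psi> x) (\<psi> x))"
  unfolding lax_eq_iff by (simp add: lax_op_def fun_eq_iff ddx_stack[OF assms])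

theorem proposition3p1:
  fixes q :: "real \<Rightarrow> complex"
  assumes "schwartz q"
  shows "\<forall>problem \<in> {DNLSE_I q, DNLSE_II q, DNLSE_III q}.
    \<exists>L :: (real \<Rightarrow> complex^4) \<Rightarrow> (real \<Rightarrow> complex^4).
      matrix_diff_op 1 L \<and>
      (\<forall>(k::complex) (\<psi> :: real \<Rightarrow> complex^2) (\<psi>h :: real \<Rightarrow> complex^2).
        (\<forall>x. \<psi> differentiable (at x)) \<longrightarrow> \<psi>h = (\<lambda>x. k *s \<psi> x) \<longrightarrow>
        (problem k \<psi> \<longleftrightarrow>
          L (\<lambda>x. stack (\<psi>h x) (\<psi> x)) = (\<lambda>x. k *s stack (\<psi>h x) (\<psi> x))))"
proof
  fix problem
  assume "problem \<in> {DNLSE_I q, DNLSE_II q, DNLSE_III q}"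
  \<comment> \<open>The scalar \<open>c\<close> is chosen before \<open>k\<close> and
    \<open>\<psi>\<close>, which makes the operator \<open>lax_op q c\<close> independent of
    \<open>k\<close>.\<close>
  then have "\<exists>c. \<forall>k \<psi>. problem k \<psi> \<longleftrightarrow> (\<forall>x. ddx \<psi> x + (\<i> * k^2) *s (sigma3 *v \<psi> x) =
      k *s (Qmat q x *v \<psi> x) + c *s ((Qmat q x ** Qmat q x ** sigma3) *v \<psi> x))"
  proof (elim insertE emptyE)
    assume "problem = DNLSE_I q"
    then show ?thesis by (intro exI[of _ 0]) (simp add: DNLSE_I_def)
  next
    assume "problem = DNLSE_II q"
    then show ?thesis by (intro exI[of _ "\<i> / 4"]) (simp add: DNLSE_II_def)
  next
    assume "problem = DNLSE_III q"
    \<comment> \<open>Problem (III) subtracts its quadratic term, so the sign has to be absorbed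
      into \<open>c\<close>.\<close>
    moreover have "(- \<i> / 2) *s w = - ((\<i> / 2) *s w)" for w :: "complex^2"
      by (simp add: vec_eq_iff)
    ultimately show ?thesis by (intro exI[of _ "- \<i> / 2"]) (simp add: DNLSE_III_def)
  qed
  then obtain c where c: "\<And>k \<psi>. problem k \<psi> \<longleftrightarrow>
      (\<forall>x. ddx \<psi> x + (\<i> * k^2) *s (sigma3 *v \<psi> x) =
        k *s (Qmat q x *v \<psi> x) + c *s ((Qmat q x ** Qmat q x ** sigma3) *v \<psi> x))"
    by blast
  have "smooth q" using assms by (simp add: schwartz_def)
  then show "\<exists>L. matrix_diff_op 1 L \<and> (\<forall>k \<psi> \<psi>h. (\<forall>x. \<psi> differentiable (at x)) \<longrightarrow>
      \<psi>h = (\<lambda>x. k *s \<psi> x) \<longrightarrow> (problem k \<psi> \<longleftrightarrow>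
        L (\<lambda>x. stack (\<psi>h x) (\<psi> x)) = (\<lambda>x. k *s stack (\<psi>h x) (\<psi> x))))"
    by (intro exI[of _ "lax_op q c"] conjI matrix_diff_op_lax_op) (simp_all add: c lax_problem_iff)
qed

end
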